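(* There is a function $m:\mathbb{Z}_{>0}\to\mathbb{R}$ such that for every positive integer $n$ and every $n$-by-$n$ doubly nonnegative matrix $A$, the matrix $A^t$ is doubly nonnegative for all $t \geq m(n)$.
   Context: A real $n$-by-$n$ matrix is doubly nonnegative if it is symmetric, positive semidefinite, and entry-wise nonnegative. For a positive semidefinite matrix $A=\lambda_1x_1x_1^T+\cdots+\lambda_nx_nx_n^T$ (spectral decomposition with orthonormal eigenvectors $x_i$ and eigenvalues $\lambda_i\ge 0$) and real $t>0$, the power is defined by $A^t=\lambda_1^t x_1x_1^T+\cdots+\lambda_n^t x_nx_n^T$. *)

theory Defs
  imports "Jordan_Normal_Form.Matrix"
begin

definition positive_semidefinite :: "real mat \<Rightarrow> bool" where
  "positive_semidefinite A \<longleftrightarrow> A \<in> carrier_mat (dim_row A) (dim_row A) \<and> A\<^sup>T = A \<and>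
     (\<forall>v \<in> carrier_vec (dim_row A). v \<bullet> (A *\<^sub>v v) \<ge> 0)"

definition doubly_nonnegative :: "real mat \<Rightarrow> bool" where
  "doubly_nonnegative A \<longleftrightarrow> A \<in> carrier_mat (dim_row A) (dim_row A) \<and> A\<^sup>T = A \<and>
     positive_semidefinite A \<and>
     (\<forall>i < dim_row A. \<forall>j < dim_row A. A $$ (i, j) \<ge> 0)"

definition spectral_decomp :: "real mat \<Rightarrow> (nat \<Rightarrow> real) \<Rightarrow> (nat \<Rightarrow> real vec) \<Rightarrow> bool" where
  "spectral_decomp A lam x \<longleftrightarrow>
     (let n = dim_row A in
       A \<in> carrier_mat n n \<and>
       (\<forall>i < n. x i \<in> carrier_vec n) \<and>
       (\<forall>i < n. \<forall>j < n. x i \<bullet> x j = (if i = j then 1 else 0)) \<and>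
       (\<forall>i < n. lam i \<ge> 0) \<and>
       A = mat n n (\<lambda>(j, k). \<Sum>i<n. lam i * (x i $ j) * (x i $ k)))"

text \<open>The power A^t = sum_i lam_i^t x_i x_i^T (t > 0) of a positive semidefinite matrix,
  for any spectral decomposition (the result does not depend on the choice).\<close>
definition psd_power :: "real mat \<Rightarrow> real \<Rightarrow> real mat" where
  "psd_power A t = (THE B. \<exists>lam x. spectral_decomp A lam x \<and>
      B = mat (dim_row A) (dim_row A)
            (\<lambda>(j, k). \<Sum>i<dim_row A. (lam i powr t) * (x i $ j) * (x i $ k)))"

end

theory Submission
  imports Defs "Jordan_Normal_Form.Determinant" "HOL-Analysis.Function_Topology"
begin

text \<open>Each entry of \<open>A\<^sup>t\<close> is an exponential sum in \<open>t\<close> with at most \<open>n\<close> terms, so unless it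
  vanishes identically it has fewer than \<open>n\<close> zeros. It is nonnegative at the positive integers,
  hence it can be negative somewhere on fewer than \<open>n\<close> of the intervals \<open>[k, k + 1]\<close>: each of them
  contributes a zero in \<open>[k, k + 1)\<close>. As there are \<open>n\<^sup>2\<close> entries, for some \<open>k \<le> n\<^sup>3 + 1\<close> all
  \<open>A\<^sup>t\<close> with \<open>t\<close> in \<open>[k, k + 1]\<close> are entrywise nonnegative, and multiplying by the nonnegative
  matrices \<open>A\<^sup>j\<close> extends this to all \<open>t \<ge> k\<close>.\<close>

subsection \<open>Zeros of exponential sums\<close>

text \<open>Rolle's theorem gives a zero of \<open>f'\<close> in each gap between consecutive points
  of \<open>Z\<close>, and the gaps are disjoint. The bound with \<open>Suc\<close> also covers
  empty \<open>Z\<close>.\<close>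

lemma Rolle_finite_zeros:
  fixes f f' :: "real \<Rightarrow> real"
  assumes der: "\<And>t. (f has_real_derivative f' t) (at t)"
    and Z: "finite Z" "\<And>z. z \<in> Z \<Longrightarrow> f z = 0"
  shows "\<exists>Z'. finite Z' \<and> card Z \<le> Suc (card Z') \<and> (\<forall>z\<in>Z'. f' z = 0)"
proof (cases "Z = {}")
  case True
  then show ?thesis by (intro exI[of _ "{}"]) auto
next
  case False
  define W where "W = Z - {Max Z}"
  define nxt where "nxt z = Min {w \<in> Z. z < w}" for z
  have nxt: "nxt z \<in> Z" "z < nxt z" "\<And>w. w \<in> Z \<Longrightarrow> z < w \<Longrightarrow> nxt z \<le> w" if "z \<in> W" for z
  proof -
    have "Max Z \<in> {w \<in> Z. z < w}"
      using that Z(1) False by (auto simp: W_def less_le)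
    then have "nxt z \<in> {w \<in> Z. z < w}"
      unfolding nxt_def using Z(1) by (intro Min_in) auto
    then show "nxt z \<in> Z" "z < nxt z" by auto
    show "nxt z \<le> w" if "w \<in> Z" "z < w" for w
      unfolding nxt_def using Z(1) that by (intro Min_le) auto
  qed
  have "\<exists>y. z < y \<and> y < nxt z \<and> f' y = 0" if "z \<in> W" for z
  proof -
    have "\<exists>y. z < y \<and> y < nxt z \<and> (\<lambda>h. h * f' y) = (\<lambda>v. 0)"
    proof (rule Rolle_deriv)
      show "z < nxt z" using nxt that by auto
      show "f z = f (nxt z)" using Z(2) nxt(1)[OF that] that by (auto simp: W_def)
      show "continuous_on {z..nxt z} f"
        using der DERIV_isCont by (intro continuous_at_imp_continuous_on) blast
      show "(f has_derivative (\<lambda>h. h * f' y)) (at y)" for y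
        using der[of y] by (simp add: has_field_derivative_def mult_commute_abs)
    qed
    then show ?thesis by (metis mult_1)
  qed
  then obtain y where y: "\<And>z. z \<in> W \<Longrightarrow> z < y z \<and> y z < nxt z \<and> f' (y z) = 0"
    by metis
  have "inj_on y W"
  proof (rule linorder_inj_onI')
    fix z w assume *: "z \<in> W" "w \<in> W" "z < w"
    then have "y z < nxt z" "nxt z \<le> w" "w < y w"
      using y nxt(3)[of z w] by (auto simp: W_def)
    then show "y z \<noteq> y w" by simp
  qed
  then have "card (y ` W) = card W" by (rule card_image)
  moreover have "card Z = Suc (card W)"
    unfolding W_def using Z(1) False by (intro card.remove Max_in)
  ultimately show ?thesis
    using y Z(1) by (intro exI[of _ "y ` W"]) (auto simp: W_def)
qed

text \<open>Dividing by one of the exponentials and differentiating removes one term and, by Rolle, at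
  most one zero.\<close>
lemma exp_sum_zero_if_many_zeros:
  fixes c u :: "'a \<Rightarrow> real"
  assumes "finite S" "finite Z" "card S \<le> card Z"
    and "\<And>z. z \<in> Z \<Longrightarrow> (\<Sum>i\<in>S. c i * exp (u i * z)) = 0"
  shows "(\<Sum>i\<in>S. c i * exp (u i * t)) = 0"
  using assms
proof (induction S arbitrary: c u Z t rule: finite_induct)
  case empty
  then show ?case by simp
next
  case (insert s S)
  define g where "g t = c s + (\<Sum>i\<in>S. c i * exp ((u i - u s) * t))" for t
  \<comment> \<open>Differentiation kills the constant \<open>c s\<close> and leaves a sum over
    \<open>S\<close> for the induction hypothesis; an exponent equal to \<open>u s\<close> just
    yields a zero coefficient.\<close>
  define g' where "g' t = (\<Sum>i\<in>S. (c i * (u i - u s)) * exp ((u i - u s) * t))" for t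
  have g: "(\<Sum>i\<in>insert s S. c i * exp (u i * t)) = exp (u s * t) * g t" for t
  proof -
    have "exp (u i * t) = exp (u s * t) * exp ((u i - u s) * t)" for i
      by (simp add: left_diff_distrib flip: exp_add)
    then have "c i * exp (u i * t) = exp (u s * t) * (c i * exp ((u i - u s) * t))" for i
      by (metis mult.left_commute)
    then have "(\<Sum>i\<in>S. c i * exp (u i * t)) = exp (u s * t) * (\<Sum>i\<in>S. c i * exp ((u i - u s) * t))"
      unfolding sum_distrib_left by (intro sum.cong refl)
    then show ?thesis
      using insert.hyps by (simp add: g_def distrib_left)
  qed
  have der: "(g has_real_derivative g' t) (at t)" for t
    unfolding g_def g'_def by (auto intro!: derivative_eq_intros sum.cong)
  have gZ: "g z = 0" if "z \<in> Z" for z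
    using insert.prems(3)[OF that] unfolding g by simp
  obtain Z' where Z': "finite Z'" "card Z \<le> Suc (card Z')" "\<And>z. z \<in> Z' \<Longrightarrow> g' z = 0"
    using Rolle_finite_zeros[OF der insert.prems(1) gZ] by blast
  have "card S \<le> card Z'" using Z'(2) insert.prems(2) insert.hyps by simp
  then have "g' t = 0" for t
    unfolding g'_def by (rule insert.IH[OF Z'(1)]) (use Z'(3) in \<open>simp add: g'_def\<close>)
  then have const: "g a = g b" for a b
    using der DERIV_isconst_all[of g] by metis
  have "Z \<noteq> {}" using insert.prems(2) insert.hyps by auto
  then have "g t = 0" using gZ const by (metis ex_in_conv)
  then show ?case unfolding g by simp
qed

subsection \<open>Orthonormal eigenvectors of symmetric matrices\<close>

text \<open>Vectors are functions of which only the entries below \<open>n\<close> count. As points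
  of a product space they inherit the topology that supplies compactness in the eigenvector
  argument.\<close>

definition ip :: "nat \<Rightarrow> (nat \<Rightarrow> real) \<Rightarrow> (nat \<Rightarrow> real) \<Rightarrow> real" where
  "ip n v w = (\<Sum>i<n. v i * w i)"

definition mulv :: "nat \<Rightarrow> (nat \<Rightarrow> nat \<Rightarrow> real) \<Rightarrow> (nat \<Rightarrow> real) \<Rightarrow> nat \<Rightarrow> real" where
  "mulv n a v r = (\<Sum>s<n. a r s * v s)"

definition orthonormal_upto :: "nat \<Rightarrow> nat \<Rightarrow> (nat \<Rightarrow> nat \<Rightarrow> real) \<Rightarrow> bool" where
  "orthonormal_upto n k x \<longleftrightarrow> (\<forall>i<k. \<forall>j<k. ip n (x i) (x j) = (if i = j then 1 else 0))"

lemma ip_commute: "ip n v w = ip n w v"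
  by (simp add: ip_def mult.commute)

lemma ip_add_left: "ip n (\<lambda>r. v r + w r) u = ip n v u + ip n w u"
  by (simp add: ip_def sum.distrib algebra_simps)

lemma ip_diff_left: "ip n (\<lambda>r. v r - w r) u = ip n v u - ip n w u"
  by (simp add: ip_def sum_subtractf algebra_simps)

lemma ip_scale_left: "ip n (\<lambda>r. c * v r) u = c * ip n v u"
  by (simp add: ip_def sum_distrib_left algebra_simps)

lemma ip_add_right: "ip n u (\<lambda>r. v r + w r) = ip n u v + ip n u w"
  by (simp add: ip_def sum.distrib algebra_simps)

lemma ip_scale_right: "ip n u (\<lambda>r. c * v r) = c * ip n u v"
  by (simp add: ip_def sum_distrib_left algebra_simps)

lemma ip_cong: "(\<And>r. r < n \<Longrightarrow> v r = v' r) \<Longrightarrow> (\<And>r. r < n \<Longrightarrow> w r = w' r) \<Longrightarrow> ip n v w = ip n v' w'"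
  by (simp add: ip_def)

lemma ip_self_nonneg: "ip n v v \<ge> 0"
  by (simp add: ip_def sum_nonneg)

lemma ip_self_eq_0: "ip n v v = 0 \<longleftrightarrow> (\<forall>r<n. v r = 0)"
  by (auto simp: ip_def sum_nonneg_eq_0_iff)

lemma mulv_add: "mulv n a (\<lambda>r. v r + w r) = (\<lambda>r. mulv n a v r + mulv n a w r)"
  by (simp add: fun_eq_iff mulv_def sum.distrib algebra_simps)

lemma mulv_scale: "mulv n a (\<lambda>r. c * v r) = (\<lambda>r. c * mulv n a v r)"
  by (simp add: fun_eq_iff mulv_def sum_distrib_left algebra_simps)

lemma mulv_cong: "(\<And>r. r < n \<Longrightarrow> v r = v' r) \<Longrightarrow> mulv n a v = mulv n a v'"
  by (simp add: fun_eq_iff mulv_def)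

lemma ip_mulv_symmetric:
  assumes "\<And>i j. i < n \<Longrightarrow> j < n \<Longrightarrow> a i j = a j i"
  shows "ip n (mulv n a v) w = ip n v (mulv n a w)"
proof -
  have "ip n (mulv n a v) w = (\<Sum>i<n. \<Sum>j<n. a i j * v j * w i)"
    by (simp add: ip_def mulv_def sum_distrib_right)
  also have "\<dots> = (\<Sum>j<n. \<Sum>i<n. a i j * v j * w i)"
    by (rule sum.swap)
  also have "\<dots> = (\<Sum>j<n. \<Sum>i<n. v j * (a j i * w i))"
    using assms by (intro sum.cong) auto
  also have "\<dots> = ip n v (mulv n a w)"
    by (simp add: ip_def mulv_def sum_distrib_left)
  finally show ?thesis .
qed

text \<open>The sum over \<open>i\<close> of \<open>x i j * x i j\<close> is the squared length of
  the projection of the standard basis vector \<open>e_j\<close> onto the span of the system. Over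
  all \<open>j\<close> these add up to \<open>k < n\<close>, so some \<open>e_j\<close> lies outside
  the span, and its residual can be normalised.\<close>

lemma exists_unit_orthogonal:
  assumes x: "orthonormal_upto n k x" and "k < n"
  shows "\<exists>v. ip n v v = 1 \<and> (\<forall>i<k. ip n v (x i) = 0) \<and> (\<forall>r\<ge>n. v r = 0)"
proof -
  have "\<exists>j<n. (\<Sum>i<k. x i j * x i j) < 1"
  proof (rule ccontr)
    assume "\<not> ?thesis"
    then have "(\<Sum>j<n. (1::real)) \<le> (\<Sum>j<n. \<Sum>i<k. x i j * x i j)"
      by (intro sum_mono) auto
    also have "\<dots> = (\<Sum>i<k. ip n (x i) (x i))"
      unfolding ip_def by (rule sum.swap)
    also have "\<dots> = real k" using x by (simp add: orthonormal_upto_def)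
    finally show False using \<open>k < n\<close> by simp
  qed
  then obtain j where j: "j < n" "(\<Sum>i<k. x i j * x i j) < 1" by blast
  \<comment> \<open>The residual of \<open>e_j\<close>. Its coordinate \<open>j\<close> is 1 minus
    the sum bounded in the choice of \<open>j\<close>, hence positive.\<close>
  define w where "w r = (if r = j then 1 else 0) - (\<Sum>i<k. x i j * x i r)" for r
  have w_orth: "ip n w (x l) = 0" if "l < k" for l
  proof -
    have "ip n w (x l) = (\<Sum>r<n. if r = j then x l r else 0) - (\<Sum>r<n. \<Sum>i<k. x i j * x i r * x l r)"
      unfolding ip_def w_def left_diff_distrib sum_subtractf sum_distrib_right
      by (intro arg_cong2[where f = minus] sum.cong) auto
    also have "(\<Sum>r<n. \<Sum>i<k. x i j * x i r * x l r) = (\<Sum>i<k. \<Sum>r<n. x i j * x i r * x l r)"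
      by (rule sum.swap)
    also have "\<dots> = (\<Sum>i<k. x i j * ip n (x i) (x l))"
      by (simp add: ip_def sum_distrib_left mult.assoc)
    also have "\<dots> = (\<Sum>i<k. if i = l then x i j else 0)"
      using x that by (intro sum.cong) (auto simp: orthonormal_upto_def)
    also have "\<dots> = x l j" using that by simp
    finally show ?thesis using j(1) by simp
  qed
  have "w j \<noteq> 0" using j(2) by (simp add: w_def)
  then have "ip n w w > 0"
    using ip_self_eq_0[of n w] ip_self_nonneg[of n w] j(1) by force
  define v where "v r = (if r < n then (1 / sqrt (ip n w w)) * w r else 0)" for r
  have "ip n v u = (1 / sqrt (ip n w w)) * ip n w u" for u
    by (subst ip_scale_left[symmetric], rule ip_cong) (auto simp: v_def)
  moreover have "ip n w v = (1 / sqrt (ip n w w)) * ip n w w"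
    by (subst ip_scale_right[symmetric], rule ip_cong) (auto simp: v_def)
  ultimately have "ip n v v = 1" "\<forall>i<k. ip n v (x i) = 0"
    using \<open>ip n w w > 0\<close> w_orth by auto
  then show ?thesis by (intro exI[of _ v]) (simp add: v_def)
qed

text \<open>First-order condition at an extremum: \<open>e\<^sup>2 * C - 2 * e * b\<close> is
  minimal at \<open>e = 0\<close>, so its derivative there vanishes.\<close>

lemma linear_le_quadratic_imp_zero:
  fixes b C :: real
  assumes "\<And>e. 2 * e * b \<le> e\<^sup>2 * C"
  shows "b = 0"
proof (rule ccontr)
  assume "b \<noteq> 0"
  \<comment> \<open>Any positive number above \<open>C\<close> would do: with
    \<open>b = e * D\<close>, cancelling \<open>e\<^sup>2\<close> turns the hypothesis into
    \<open>2 * D \<le> C\<close>.\<close>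
  define D where "D = \<bar>C\<bar> + 1"
  have D: "D > 0" "C < D" by (auto simp: D_def)
  define e where "e = b / D"
  have b: "b = e * D" using D by (simp add: e_def)
  then have "e \<noteq> 0" using \<open>b \<noteq> 0\<close> by auto
  then have "e\<^sup>2 > 0" by simp
  moreover have "e\<^sup>2 * (2 * D) \<le> e\<^sup>2 * C"
    using assms[of e] b by (simp add: power2_eq_square algebra_simps)
  ultimately have "2 * D \<le> C" by (simp only: mult_le_cancel_left_pos)
  then show False using D by linarith
qed

text \<open>The new eigenvector maximises the Rayleigh quotient on the orthogonal complement of the
  previous ones.\<close>
lemma symmetric_next_eigenvector:
  assumes sym: "\<And>i j. i < n \<Longrightarrow> j < n \<Longrightarrow> a i j = a j i"
    and x: "orthonormal_upto n k x" and "k < n"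
    and eig: "\<And>i r. i < k \<Longrightarrow> r < n \<Longrightarrow> mulv n a (x i) r = lam i * x i r"
  shows "\<exists>v \<mu>. ip n v v = 1 \<and> (\<forall>i<k. ip n v (x i) = 0) \<and> (\<forall>r<n. mulv n a v r = \<mu> * v r)"
proof -
  define q where "q v = ip n (mulv n a v) v" for v
  \<comment> \<open>Pinning the coordinates from \<open>n\<close> on to 0 makes this a product of
    compact sets, so Tychonoff applies. The closed conditions in \<open>K\<close> cut out the unit
    sphere of the orthogonal complement.\<close>
  define box :: "(nat \<Rightarrow> real) set" where "box = (\<Pi>\<^sub>E i\<in>UNIV. if i < n then {-1..1} else {0})"
  define K where "K = box \<inter> ({v. ip n v v = 1} \<inter> (\<Inter>i<k. {v. ip n v (x i) = 0}))"
  have coord: "continuous_on S (\<lambda>v :: nat \<Rightarrow> real. v i)" for S i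
    by (rule continuous_on_subset[OF continuous_on_product_coordinates subset_UNIV])
  have "compact box"
    using compactin_PiE[of "\<lambda>_. euclidean" UNIV "\<lambda>i. if i < n then {-1..1} else {0::real}"]
    unfolding box_def by (simp add: euclidean_product_topology compactin_euclidean_iff)
  moreover have "closed {v. ip n v v = 1}"
    unfolding ip_def by (intro closed_Collect_eq continuous_intros coord)
  moreover have "closed {v. ip n v (x i) = 0}" for i
    unfolding ip_def by (intro closed_Collect_eq continuous_intros coord)
  ultimately have "compact K"
    unfolding K_def by (intro compact_Int_closed closed_Int closed_INT) auto
  have K_iff: "v \<in> K \<longleftrightarrow> ip n v v = 1 \<and> (\<forall>i<k. ip n v (x i) = 0) \<and> (\<forall>r\<ge>n. v r = 0)" for v
  proof -
    have "\<bar>v r\<bar> \<le> 1" if "ip n v v = 1" "r < n" for r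
    proof -
      have "v r * v r \<le> (\<Sum>i<n. v i * v i)"
        using that by (intro member_le_sum) auto
      then have "(v r)\<^sup>2 \<le> 1" using that by (simp add: ip_def power2_eq_square)
      then show ?thesis by (simp add: abs_square_le_1)
    qed
    then show ?thesis
      unfolding K_def box_def by (auto simp: PiE_iff abs_le_iff minus_le_iff split: if_splits)
  qed
  have "K \<noteq> {}" using exists_unit_orthogonal[OF x \<open>k < n\<close>] K_iff by blast
  moreover have "continuous_on K q"
    unfolding q_def ip_def mulv_def by (intro continuous_intros coord)
  ultimately obtain v where v: "v \<in> K" and vmax: "\<And>w. w \<in> K \<Longrightarrow> q w \<le> q v"
    using continuous_attains_sup[OF \<open>compact K\<close>] by blast
  have v1: "ip n v v = 1" and vx: "\<And>i. i < k \<Longrightarrow> ip n v (x i) = 0"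
    using v K_iff by auto
  \<comment> \<open>Scaling carries the maximum from unit vectors to the whole orthogonal
    complement, so the variation below needs no normalisation.\<close>
  have rayleigh: "q w \<le> q v * ip n w w" if w: "\<And>i. i < k \<Longrightarrow> ip n w (x i) = 0" for w
  proof (cases "ip n w w = 0")
    case True
    then have "q w = 0" unfolding ip_self_eq_0 by (simp add: q_def ip_def)
    then show ?thesis using True by simp
  next
    case False
    define s where "s = sqrt (ip n w w)"
    have s: "s > 0" "s * s = ip n w w"
      using False ip_self_nonneg[of n w] by (auto simp: s_def)
    define u where "u r = (if r < n then (1 / s) * w r else 0)" for r
    have u: "ip n u z = (1 / s) * ip n w z" "ip n z u = (1 / s) * ip n z w" for z
      by (simp_all add: ip_def u_def sum_distrib_left)
    have "u \<in> K" unfolding K_iff u using w s False by (simp add: u_def field_simps)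
    then have "q u \<le> q v" by (rule vmax)
    have "mulv n a u = (\<lambda>r. (1 / s) * mulv n a w r)"
      by (subst mulv_scale[symmetric], rule mulv_cong) (simp add: u_def)
    then have "q u = (1 / s) * ((1 / s) * q w)"
      unfolding q_def by (simp only: u ip_scale_left)
    then have "q u = q w / ip n w w" by (simp flip: s(2))
    moreover have "ip n w w > 0" using False ip_self_nonneg[of n w] by linarith
    ultimately show ?thesis using \<open>q u \<le> q v\<close> by (simp add: pos_divide_le_eq)
  qed
  define w where "w r = mulv n a v r - q v * v r" for r
  have w_ip: "ip n w z = ip n (mulv n a v) z - q v * ip n v z" for z
    unfolding w_def by (simp add: ip_diff_left ip_scale_left)
  have wv: "ip n w v = 0"
    by (simp add: w_ip v1 q_def)
  \<comment> \<open>The orthogonal complement is invariant, since the \<open>x i\<close> are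
    eigenvectors and \<open>a\<close> is symmetric; hence the defect \<open>w\<close> of the
    eigenvector equation is an admissible direction.\<close>
  have wx: "ip n w (x i) = 0" if "i < k" for i
  proof -
    have "ip n (mulv n a v) (x i) = ip n v (mulv n a (x i))"
      by (rule ip_mulv_symmetric[OF sym])
    also have "\<dots> = ip n v (\<lambda>r. lam i * x i r)"
      using eig that by (intro ip_cong) auto
    finally have "ip n (mulv n a v) (x i) = 0" using vx that by (simp add: ip_scale_right)
    then show ?thesis by (simp add: w_ip vx that)
  qed
  have avw: "ip n (mulv n a v) w = ip n w w"
  proof -
    have "ip n v w = 0" using wv by (simp add: ip_commute)
    then show ?thesis by (simp add: w_ip)
  qed
  \<comment> \<open>Along \<open>v + e * w\<close> the quadratic form has linear term
    \<open>2 * e * ip n w w\<close>, while the squared norm has none because \<open>w\<close> is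
    orthogonal to \<open>v\<close>; maximality forces this term to vanish.\<close>
  have "ip n w w = 0"
  proof (rule linear_le_quadratic_imp_zero)
    fix e :: real
    define z where "z r = v r + e * w r" for r
    have zz: "ip n z z = 1 + e\<^sup>2 * ip n w w"
      unfolding z_def using v1 wv
      by (simp add: ip_add_left ip_add_right ip_scale_left ip_scale_right ip_commute[of n v w]
          power2_eq_square)
    have "ip n (mulv n a w) v = ip n w w"
      using avw ip_mulv_symmetric[OF sym, where v = w and w = v] by (simp add: ip_commute)
    then have "q z = q v + 2 * e * ip n w w + e\<^sup>2 * q w"
      unfolding q_def z_def using avw
      by (simp add: mulv_add mulv_scale ip_add_left ip_add_right ip_scale_left ip_scale_right
          power2_eq_square algebra_simps)
    moreover have "q z \<le> q v * ip n z z"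
      by (rule rayleigh) (simp add: z_def[abs_def] ip_add_left ip_scale_left vx wx)
    ultimately show "2 * e * ip n w w \<le> e\<^sup>2 * (q v * ip n w w - q w)"
      unfolding zz by (simp add: algebra_simps)
  qed
  then have "\<forall>r<n. mulv n a v r = q v * v r"
    by (simp add: ip_self_eq_0 w_def)
  then show ?thesis using v1 vx by blast
qed

text \<open>Eigenvectors are adjoined one at a time to the empty system; \<open>k = n\<close> is the
  spectral theorem for symmetric matrices.\<close>

lemma symmetric_orthonormal_eigenvectors:
  assumes sym: "\<And>i j. i < n \<Longrightarrow> j < n \<Longrightarrow> a i j = a j i" and "k \<le> n"
  shows "\<exists>lam x. orthonormal_upto n k x \<and> (\<forall>i<k. \<forall>r<n. mulv n a (x i) r = lam i * x i r)"
  using \<open>k \<le> n\<close>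
proof (induction k)
  case 0
  then show ?case by (simp add: orthonormal_upto_def)
next
  case (Suc k)
  then obtain lam x where x: "orthonormal_upto n k x"
    and eig: "\<And>i r. i < k \<Longrightarrow> r < n \<Longrightarrow> mulv n a (x i) r = lam i * x i r"
    by (metis Suc_leD)
  from symmetric_next_eigenvector[OF sym x _ eig] Suc.prems
  obtain v \<mu> where v: "ip n v v = 1" "\<And>i. i < k \<Longrightarrow> ip n v (x i) = 0"
    "\<And>r. r < n \<Longrightarrow> mulv n a v r = \<mu> * v r"
    by auto
  then have "ip n (x i) v = 0" if "i < k" for i
    using that by (simp add: ip_commute[of n "x i" v])
  then have "orthonormal_upto n (Suc k) (x(k := v))"
    using x v by (auto simp: orthonormal_upto_def less_Suc_eq)
  moreover have "\<forall>i<Suc k. \<forall>r<n. mulv n a ((x(k := v)) i) r = (lam(k := \<mu>)) i * (x(k := v)) i r"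
    using eig v by (auto simp: less_Suc_eq)
  ultimately show ?case by blast
qed

subsection \<open>Functional calculus of spectral decompositions\<close>

text \<open>A one-sided inverse of a square matrix is two-sided: \<open>X * X\<^sup>T = 1\<close>
  gives \<open>X\<^sup>T * X = 1\<close>, the resolution of the identity.\<close>

lemma orthonormal_upto_complete:
  assumes x: "orthonormal_upto n n x" and "r < n" "s < n"
  shows "(\<Sum>i<n. x i r * x i s) = (if r = s then 1 else 0)"
proof -
  define X where "X = mat n n (\<lambda>(i, r). x i r)"
  have X: "X \<in> carrier_mat n n" by (simp add: X_def)
  have "X * X\<^sup>T = 1\<^sub>m n"
    using x by (intro eq_matI)
      (auto simp: X_def scalar_prod_def orthonormal_upto_def ip_def atLeast0LessThan)
  then have "X\<^sup>T * X = 1\<^sub>m n"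
    using X by (intro mat_mult_left_right_inverse[of X n]) auto
  then have "(X\<^sup>T * X) $$ (r, s) = (1\<^sub>m n :: real mat) $$ (r, s)" by simp
  then show ?thesis
    using \<open>r < n\<close> \<open>s < n\<close> by (simp add: X_def scalar_prod_def atLeast0LessThan)
qed

lemma orthonormal_upto_expansion:
  assumes x: "orthonormal_upto n n x" and "r < n"
  shows "v r = (\<Sum>i<n. ip n (x i) v * x i r)"
proof -
  have "(\<Sum>i<n. ip n (x i) v * x i r) = (\<Sum>i<n. \<Sum>s<n. v s * (x i s * x i r))"
    by (simp add: ip_def sum_distrib_left sum_distrib_right mult_ac)
  also have "\<dots> = (\<Sum>s<n. \<Sum>i<n. v s * (x i s * x i r))"
    by (rule sum.swap)
  also have "\<dots> = (\<Sum>s<n. if s = r then v s else 0)"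
    using assms by (intro sum.cong) (simp_all add: orthonormal_upto_complete flip: sum_distrib_left)
  also have "\<dots> = v r" using \<open>r < n\<close> by simp
  finally show ?thesis ..
qed

text \<open>For orthonormal \<open>x\<close>, replacing \<open>lam\<close> by a function of it gives
  the functional calculus, so one form describes a matrix, its real powers and their
  products.\<close>

definition spec_sum :: "nat \<Rightarrow> (nat \<Rightarrow> real) \<Rightarrow> (nat \<Rightarrow> nat \<Rightarrow> real) \<Rightarrow> nat \<Rightarrow> nat \<Rightarrow> real" where
  "spec_sum n lam x r s = (\<Sum>i<n. lam i * x i r * x i s)"

lemma spec_sum_commute: "spec_sum n lam x r s = spec_sum n lam x s r"
  by (simp add: spec_sum_def mult_ac)

lemma mulv_spec_sum: "mulv n (spec_sum n lam x) v r = (\<Sum>i<n. lam i * ip n (x i) v * x i r)"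
proof -
  have "mulv n (spec_sum n lam x) v r = (\<Sum>s<n. \<Sum>i<n. lam i * x i r * x i s * v s)"
    by (simp add: mulv_def spec_sum_def sum_distrib_right)
  also have "\<dots> = (\<Sum>i<n. \<Sum>s<n. lam i * x i r * x i s * v s)"
    by (rule sum.swap)
  also have "\<dots> = (\<Sum>i<n. lam i * ip n (x i) v * x i r)"
    by (simp add: ip_def sum_distrib_left sum_distrib_right mult_ac)
  finally show ?thesis .
qed

lemma ip_mulv_spec_sum:
  "ip n v (mulv n (spec_sum n lam x) w) = (\<Sum>i<n. lam i * ip n (x i) v * ip n (x i) w)"
proof -
  have "ip n v (mulv n (spec_sum n lam x) w) = (\<Sum>r<n. \<Sum>i<n. lam i * ip n (x i) w * (x i r * v r))"
    unfolding ip_def[of n v] by (simp add: mulv_spec_sum sum_distrib_left mult_ac)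
  also have "\<dots> = (\<Sum>i<n. \<Sum>r<n. lam i * ip n (x i) w * (x i r * v r))"
    by (rule sum.swap)
  also have "\<dots> = (\<Sum>i<n. lam i * ip n (x i) v * ip n (x i) w)"
    by (simp add: ip_def[of n _ v] sum_distrib_left sum_distrib_right mult_ac)
  finally show ?thesis .
qed

lemma mulv_spec_sum_eigenvector:
  assumes "orthonormal_upto n n x" "i < n"
  shows "mulv n (spec_sum n lam x) (x i) = (\<lambda>r. lam i * x i r)"
proof
  fix r
  have "mulv n (spec_sum n lam x) (x i) r = (\<Sum>j<n. if j = i then lam j * x j r else 0)"
    unfolding mulv_spec_sum using assms by (intro sum.cong) (auto simp: orthonormal_upto_def)
  then show "mulv n (spec_sum n lam x) (x i) r = lam i * x i r" using assms(2) by simp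
qed

text \<open>Matrices diagonal in a common orthonormal basis multiply eigenvalue by eigenvalue; for
  powers this becomes the semigroup law.\<close>

lemma spec_sum_mult:
  assumes x: "orthonormal_upto n n x"
  shows "(\<Sum>l<n. spec_sum n lam x r l * spec_sum n mu x l s) = spec_sum n (\<lambda>i. lam i * mu i) x r s"
proof -
  have "(\<Sum>l<n. spec_sum n lam x r l * spec_sum n mu x l s) =
      mulv n (spec_sum n lam x) (\<lambda>l. spec_sum n mu x s l) r"
    by (simp add: mulv_def spec_sum_commute[of n mu x s])
  also have "\<dots> = (\<Sum>i<n. lam i * mulv n (spec_sum n mu x) (x i) s * x i r)"
    unfolding mulv_spec_sum[of n lam] by (simp add: ip_def mulv_def mult_ac)
  also have "\<dots> = spec_sum n (\<lambda>i. lam i * mu i) x r s"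
    unfolding spec_sum_def[of n "\<lambda>i. lam i * mu i"]
    using x by (intro sum.cong) (simp_all add: mulv_spec_sum_eigenvector)
  finally show ?thesis .
qed

lemma spec_sum_of_eigenvectors:
  assumes x: "orthonormal_upto n n x"
    and eig: "\<And>i r. i < n \<Longrightarrow> r < n \<Longrightarrow> mulv n a (x i) r = lam i * x i r"
    and "r < n" "s < n"
  shows "a r s = spec_sum n lam x r s"
proof -
  have "a r s = (\<Sum>i<n. ip n (x i) (a r) * x i s)"
    by (rule orthonormal_upto_expansion[OF x \<open>s < n\<close>])
  also have "\<dots> = (\<Sum>i<n. mulv n a (x i) r * x i s)"
    by (simp add: ip_def mulv_def mult_ac)
  finally show ?thesis
    using eig \<open>r < n\<close> by (simp add: spec_sum_def)
qed

text \<open>Eigenvectors of the two decompositions are orthogonal unless their eigenvalues agree, so a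
  function of the eigenvalues may be moved from one decomposition to the other.\<close>
lemma spec_sum_function_unique:
  assumes x: "orthonormal_upto n n x" and y: "orthonormal_upto n n y"
    and eq: "\<And>r s. r < n \<Longrightarrow> s < n \<Longrightarrow> spec_sum n lam x r s = spec_sum n mu y r s"
    and "r < n" "s < n"
  shows "spec_sum n (\<lambda>i. f (lam i)) x r s = spec_sum n (\<lambda>i. f (mu i)) y r s"
proof -
  have *: "f (lam i) * ip n (x i) (y j) = f (mu j) * ip n (x i) (y j)" if "i < n" "j < n" for i j
  proof -
    have "lam i * ip n (x i) (y j) = ip n (mulv n (spec_sum n lam x) (x i)) (y j)"
      using x that by (simp add: mulv_spec_sum_eigenvector ip_scale_left)
    also have "\<dots> = ip n (x i) (mulv n (spec_sum n lam x) (y j))"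
      by (rule ip_mulv_symmetric) (rule spec_sum_commute)
    also have "\<dots> = ip n (x i) (mulv n (spec_sum n mu y) (y j))"
      using eq by (intro ip_cong) (auto simp: mulv_def)
    also have "\<dots> = mu j * ip n (x i) (y j)"
      using y that by (simp add: mulv_spec_sum_eigenvector ip_scale_right)
    finally show ?thesis by auto
  qed
  \<comment> \<open>Expand \<open>x i\<close> in the basis \<open>y\<close>, exchange
    \<open>f (lam i)\<close> for \<open>f (mu j)\<close> termwise, and reassemble \<open>y j\<close>
    from its expansion in the basis \<open>x\<close>.\<close>
  have "spec_sum n (\<lambda>i. f (lam i)) x r s
      = (\<Sum>i<n. f (lam i) * x i r * (\<Sum>j<n. ip n (y j) (x i) * y j s))"
    unfolding spec_sum_def orthonormal_upto_expansion[OF y \<open>s < n\<close>, of "x _", symmetric] ..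
  also have "\<dots> = (\<Sum>i<n. \<Sum>j<n. (f (lam i) * ip n (x i) (y j)) * x i r * y j s)"
    by (simp add: sum_distrib_left ip_commute[of n "y _"] mult_ac)
  also have "\<dots> = (\<Sum>i<n. \<Sum>j<n. (f (mu j) * ip n (x i) (y j)) * x i r * y j s)"
    using * by (intro sum.cong) auto
  also have "\<dots> = (\<Sum>j<n. \<Sum>i<n. (f (mu j) * ip n (x i) (y j)) * x i r * y j s)"
    by (rule sum.swap)
  also have "\<dots> = (\<Sum>j<n. f (mu j) * (\<Sum>i<n. ip n (x i) (y j) * x i r) * y j s)"
    by (simp add: sum_distrib_left sum_distrib_right mult_ac)
  also have "\<dots> = spec_sum n (\<lambda>i. f (mu i)) y r s"
    unfolding spec_sum_def using orthonormal_upto_expansion[OF x \<open>r < n\<close>, symmetric] by simp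
  finally show ?thesis .
qed

section \<open>From coordinate functions to matrices and \<open>psd_power\<close>\<close>

lemma spectral_decomp_iff:
  assumes "A \<in> carrier_mat n n"
  shows "spectral_decomp A lam x \<longleftrightarrow>
    (\<forall>i<n. x i \<in> carrier_vec n) \<and> orthonormal_upto n n (\<lambda>i r. x i $ r) \<and> (\<forall>i<n. lam i \<ge> 0) \<and>
    (\<forall>r<n. \<forall>s<n. A $$ (r, s) = spec_sum n lam (\<lambda>i r. x i $ r) r s)"
proof -
  have "scalar_prod (x i) (x j) = ip n (\<lambda>r. x i $ r) (\<lambda>r. x j $ r)"
    if "\<forall>i<n. x i \<in> carrier_vec n" "j < n" for i j
  proof -
    have "dim_vec (x j) = n" using that by auto
    then show ?thesis by (simp add: ip_def scalar_prod_def atLeast0LessThan)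
  qed
  then have "(\<forall>i<n. \<forall>j<n. scalar_prod (x i) (x j) = (if i = j then 1 else 0)) \<longleftrightarrow>
      orthonormal_upto n n (\<lambda>i r. x i $ r)" if "\<forall>i<n. x i \<in> carrier_vec n"
    using that by (simp add: orthonormal_upto_def)
  moreover have "A = mat n n (\<lambda>(j, k). \<Sum>i<n. lam i * (x i $ j) * (x i $ k)) \<longleftrightarrow>
      (\<forall>r<n. \<forall>s<n. A $$ (r, s) = spec_sum n lam (\<lambda>i r. x i $ r) r s)"
    using assms by (subst mat_eq_iff) (simp add: spec_sum_def)
  ultimately show ?thesis
    using assms unfolding spectral_decomp_def by (auto simp: Let_def)
qed

lemma scalar_prod_mult_mat_vec_eq_ip:
  assumes "A \<in> carrier_mat n n" "v \<in> carrier_vec n"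
    and "\<And>r s. r < n \<Longrightarrow> s < n \<Longrightarrow> A $$ (r, s) = a r s"
  shows "scalar_prod v (A *\<^sub>v v) = ip n (\<lambda>r. v $ r) (mulv n a (\<lambda>r. v $ r))"
  using assms by (simp add: scalar_prod_def ip_def mulv_def atLeast0LessThan)

text \<open>Symmetry provides orthonormal eigenvectors, and \<open>lam i\<close> is the value of the
  quadratic form at \<open>x i\<close>, hence nonnegative.\<close>

lemma positive_semidefinite_imp_spectral_decomp:
  assumes A: "A \<in> carrier_mat n n" and "positive_semidefinite A"
  shows "\<exists>lam x. spectral_decomp A lam x"
proof -
  define a where "a r s = A $$ (r, s)" for r s
  have "A\<^sup>T = A" and psd: "\<And>v. v \<in> carrier_vec n \<Longrightarrow> scalar_prod v (A *\<^sub>v v) \<ge> 0"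
    using assms by (auto simp: positive_semidefinite_def)
  then have sym: "a i j = a j i" if "i < n" "j < n" for i j
    using that A index_transpose_mat(1)[of i A j] by (simp add: a_def)
  obtain lam x where x: "orthonormal_upto n n x"
    and eig: "\<And>i r. i < n \<Longrightarrow> r < n \<Longrightarrow> mulv n a (x i) r = lam i * x i r"
    using symmetric_orthonormal_eigenvectors[of n a n] sym by blast
  have nonneg: "lam i \<ge> 0" if "i < n" for i
  proof -
    have "0 \<le> scalar_prod (vec n (x i)) (A *\<^sub>v vec n (x i))" by (rule psd) simp
    also have "\<dots> = ip n (\<lambda>r. vec n (x i) $ r) (mulv n a (\<lambda>r. vec n (x i) $ r))"
      using A by (intro scalar_prod_mult_mat_vec_eq_ip) (auto simp: a_def)
    also have "\<dots> = ip n (x i) (\<lambda>r. lam i * x i r)"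
      using eig[OF that] by (intro ip_cong) (auto simp: mulv_def)
    also have "\<dots> = lam i" using x that by (simp add: ip_scale_right orthonormal_upto_def)
    finally show ?thesis .
  qed
  have "orthonormal_upto n n (\<lambda>i r. vec n (x i) $ r)"
    using x by (simp add: orthonormal_upto_def ip_def)
  moreover have "A $$ (r, s) = spec_sum n lam (\<lambda>i r. vec n (x i) $ r) r s" if "r < n" "s < n" for r s
    using spec_sum_of_eigenvectors[OF x eig that] that by (simp add: spec_sum_def a_def)
  ultimately show ?thesis
    using nonneg by (intro exI[of _ lam] exI[of _ "\<lambda>i. vec n (x i)"])
      (simp add: spectral_decomp_iff[OF A])
qed

text \<open>Justifies the definite description: a decomposition is given, and any two yield the same
  matrix because \<open>l powr t\<close> depends on the eigenvalue \<open>l\<close> alone.\<close>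

lemma psd_power_eq:
  assumes A: "A \<in> carrier_mat n n" and dec: "spectral_decomp A lam x"
  shows "psd_power A t = mat n n (\<lambda>(r, s). spec_sum n (\<lambda>i. lam i powr t) (\<lambda>i r. x i $ r) r s)"
proof -
  let ?B = "\<lambda>lam x. mat n n (\<lambda>(r, s). spec_sum n (\<lambda>i. lam i powr t) (\<lambda>i r. x i $ r) r s)"
  have unique: "?B mu y = ?B lam x" if "spectral_decomp A mu y" for mu y
    using that dec
    by (auto simp: spectral_decomp_iff[OF A]
        intro!: eq_matI spec_sum_function_unique[where f = "\<lambda>l. l powr t"])
  have "psd_power A t = (THE B. \<exists>lam x. spectral_decomp A lam x \<and> B = ?B lam x)"
    using A unfolding psd_power_def spec_sum_def by simp
  also have "\<dots> = ?B lam x"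
  proof (rule the_equality)
    show "\<exists>mu y. spectral_decomp A mu y \<and> ?B lam x = ?B mu y"
      using dec by blast
    show "B = ?B lam x" if "\<exists>mu y. spectral_decomp A mu y \<and> B = ?B mu y" for B
      using that unique by blast
  qed
  finally show ?thesis .
qed

subsection \<open>Nonnegativity of large powers\<close>

text \<open>With \<open>n\<close> bad intervals there would be at least as many distinct zeros as
  exponential terms, so \<open>f\<close> would vanish identically, contradicting its negative
  values.\<close>

lemma card_negative_intervals_less:
  fixes lam c :: "nat \<Rightarrow> real" and n :: nat
  defines "f \<equiv> \<lambda>t. \<Sum>i<n. lam i powr t * c i"
  assumes lam: "\<And>i. i < n \<Longrightarrow> lam i \<ge> 0" and "n > 0"
    and nonneg: "\<And>k. k > 0 \<Longrightarrow> f (real k) \<ge> 0"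
    and bad: "finite K" "\<And>k. k \<in> K \<Longrightarrow> k > 0 \<and> (\<exists>t\<in>{real k..real k + 1}. f t < 0)"
  shows "card K < n"
proof (rule ccontr)
  assume "\<not> card K < n"
  \<comment> \<open>Zero eigenvalues contribute nothing, as \<open>0 powr t = 0\<close> for every
    \<open>t\<close>; only the positive ones have a logarithm to serve as exponent.\<close>
  define S where "S = {i. i < n \<and> lam i > 0}"
  have f: "f t = (\<Sum>i\<in>S. c i * exp (ln (lam i) * t))" for t
  proof -
    have "f t = (\<Sum>i\<in>S. lam i powr t * c i)"
      unfolding f_def S_def using lam
      by (intro sum.mono_neutral_right) (auto simp: less_le)
    also have "\<dots> = (\<Sum>i\<in>S. c i * exp (ln (lam i) * t))"
      by (intro sum.cong) (auto simp: S_def powr_def mult_ac)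
    finally show ?thesis .
  qed
  have cont: "continuous_on X f" for X
    unfolding f[abs_def] by (intro continuous_intros)
  have "\<exists>z\<in>{real k..<real k + 1}. f z = 0" if "k \<in> K" for k
  proof -
    obtain t where t: "real k \<le> t" "t \<le> real k + 1" "f t < 0"
      using bad(2)[OF \<open>k \<in> K\<close>] by auto
    \<comment> \<open>Excluding the right endpoint places the zero in a half-open interval, so
      neighbouring intervals cannot share it.\<close>
    have "t \<noteq> real k + 1" using nonneg[of "Suc k"] t(3) by (auto simp: add.commute)
    moreover obtain z where "real k \<le> z" "z \<le> t" "f z = 0"
      using IVT2'[of f t 0 "real k"] t nonneg[of k] bad(2)[OF \<open>k \<in> K\<close>] cont by auto
    ultimately show ?thesis using t by (intro bexI[of _ z]) auto
  qed
  then obtain z where z: "\<And>k. k \<in> K \<Longrightarrow> z k \<in> {real k..<real k + 1} \<and> f (z k) = 0"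
    by metis
  have "k = l" if "k \<in> K" "l \<in> K" "z k = z l" for k l
  proof -
    have "real k < real l + 1" "real l < real k + 1" using z[OF that(1)] z[OF that(2)] that(3) by auto
    then show ?thesis by linarith
  qed
  then have "card (z ` K) = card K" by (intro card_image inj_onI)
  moreover have "card S \<le> n" unfolding S_def using card_mono[of "{..<n}" "{i. i < n \<and> lam i > 0}"] by auto
  ultimately have card: "card S \<le> card (z ` K)" using \<open>\<not> card K < n\<close> by simp
  have "f t = 0" for t
    unfolding f
  proof (rule exp_sum_zero_if_many_zeros[OF _ _ card])
    show "finite S" "finite (z ` K)" using bad(1) by (simp_all add: S_def)
    show "(\<Sum>i\<in>S. c i * exp (ln (lam i) * y)) = 0" if "y \<in> z ` K" for y
      using that z unfolding f[symmetric] by blast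
  qed
  moreover have "K \<noteq> {}" using \<open>\<not> card K < n\<close> \<open>n > 0\<close> by auto
  ultimately show False using bad(2) by force
qed

lemma spec_sum_powr_nonneg:
  assumes "n > 0" and x: "orthonormal_upto n n x" and lam: "\<And>i. i < n \<Longrightarrow> lam i \<ge> 0"
    and nonneg: "\<And>r s. r < n \<Longrightarrow> s < n \<Longrightarrow> spec_sum n lam x r s \<ge> 0"
    and t: "t \<ge> real (n ^ 3 + 1)" and "r < n" "s < n"
  shows "spec_sum n (\<lambda>i. lam i powr t) x r s \<ge> 0"
proof -
  define P where "P t = spec_sum n (\<lambda>i. lam i powr t) x" for t
  \<comment> \<open>Semigroup law. Zero eigenvalues cause no exception, again because
    \<open>0 powr t = 0\<close>.\<close>
  have P_add: "P (u + v) r s = (\<Sum>l<n. P u r l * P v l s)" for u v r s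
    unfolding P_def spec_sum_mult[OF x] by (simp add: powr_add)
  have P_one: "P 1 r s = spec_sum n lam x r s" for r s
    unfolding P_def spec_sum_def using lam by (intro sum.cong) auto
  \<comment> \<open>The induction starts at 1: with \<open>0 powr 0 = 0\<close>, \<open>P 0\<close>
    is the projection onto the range of the matrix and may have negative entries. This is also why
    \<open>j = 0\<close> is a separate case at the end.\<close>
  have P_int: "P (real k) r s \<ge> 0" if "k > 0" "r < n" "s < n" for k r s
    using that
  proof (induction k arbitrary: r s rule: nat_induct_non_zero)
    case 1
    then show ?case using nonneg by (simp add: P_one)
  next
    case (Suc k)
    have "P (real k + 1) r s \<ge> 0"
      unfolding P_add
    proof (intro sum_nonneg mult_nonneg_nonneg)
      fix l assume l: "l \<in> {..<n}"
      from Suc l show "P (real k) r l \<ge> 0" by simp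
      from Suc l show "P 1 l s \<ge> 0" using nonneg by (simp add: P_one)
    qed
    then show ?case by (simp add: add.commute)
  qed
  define bad where "bad r s = {k \<in> {1..n ^ 3 + 1}. \<exists>t\<in>{real k..real k + 1}. P t r s < 0}" for r s
  have card_bad: "card (bad r s) \<le> n" if "r < n" "s < n" for r s
  proof -
    have P_eq: "P t r s = (\<Sum>i<n. lam i powr t * (x i r * x i s))" for t
      by (simp add: P_def spec_sum_def mult_ac)
    have "card (bad r s) < n"
    proof (rule card_negative_intervals_less)
      show "n > 0" "\<And>i. i < n \<Longrightarrow> lam i \<ge> 0" by fact+
      show "finite (bad r s)" by (simp add: bad_def)
      show "0 \<le> (\<Sum>i<n. lam i powr real k * (x i r * x i s))" if "k > 0" for k
        using P_int[OF that \<open>r < n\<close> \<open>s < n\<close>] unfolding P_eq .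
      show "k > 0 \<and> (\<exists>t\<in>{real k..real k + 1}. (\<Sum>i<n. lam i powr t * (x i r * x i s)) < 0)"
        if "k \<in> bad r s" for k
        using that unfolding bad_def P_eq by simp
    qed
    then show ?thesis by simp
  qed
  \<comment> \<open>Union bound: \<open>n * n\<close> entries with at most \<open>n\<close> bad
    intervals each cannot exhaust \<open>n ^ 3 + 1\<close> candidates. This fixes the
    threshold.\<close>
  have "card (\<Union>(r, s)\<in>{..<n} \<times> {..<n}. bad r s) \<le> (\<Sum>(r, s)\<in>{..<n} \<times> {..<n}. card (bad r s))"
    using card_UN_le[of "{..<n} \<times> {..<n}" "\<lambda>(r, s). bad r s"] by (simp add: case_prod_unfold)
  also have "\<dots> \<le> (\<Sum>(r, s)\<in>{..<n} \<times> {..<n}. n)"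
    using card_bad by (intro sum_mono) auto
  also have "\<dots> < card {1..n ^ 3 + 1}"
    by (simp add: power3_eq_cube)
  finally have "\<not> {1..n ^ 3 + 1} \<subseteq> (\<Union>(r, s)\<in>{..<n} \<times> {..<n}. bad r s)"
    using card_mono[of "\<Union>(r, s)\<in>{..<n} \<times> {..<n}. bad r s" "{1..n ^ 3 + 1}"]
    by (auto simp: bad_def)
  then obtain k where "k \<in> {1..n ^ 3 + 1}" "k \<notin> (\<Union>(r, s)\<in>{..<n} \<times> {..<n}. bad r s)"
    by blast
  then have k: "k \<in> {1..n ^ 3 + 1}" "\<And>r s. r < n \<Longrightarrow> s < n \<Longrightarrow> k \<notin> bad r s"
    by auto
  then have good: "P u r s \<ge> 0" if "u \<in> {real k..real k + 1}" "r < n" "s < n" for u r s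
    using that by (force simp: bad_def not_less)
  \<comment> \<open>Split \<open>t\<close> into an integer \<open>j\<close> and a remainder in the
    good interval; the floor is nonnegative because
    \<open>k \<le> n ^ 3 + 1 \<le> t\<close>.\<close>
  define j where "j = nat \<lfloor>t - real k\<rfloor>"
  have tk: "t \<ge> real k" using t k(1) by (metis atLeastAtMost_iff of_nat_le_iff order_trans)
  then have "real j = of_int \<lfloor>t - real k\<rfloor>"
    by (simp add: j_def)
  then have "real j \<le> t - real k" "t - real k < real j + 1"
    using floor_correct[of "t - real k"] by auto
  then have j: "t - real j \<in> {real k..real k + 1}"
    by simp
  have "P t r s \<ge> 0"
  proof (cases "j = 0")
    case True
    then show ?thesis using good[of t] j \<open>r < n\<close> \<open>s < n\<close> by simp
  next
    case False
    have "P ((t - real j) + real j) r s \<ge> 0"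
      unfolding P_add using good[OF j] P_int[of j] False \<open>r < n\<close> \<open>s < n\<close>
      by (intro sum_nonneg mult_nonneg_nonneg) auto
    then show ?thesis by simp
  qed
  then show ?thesis by (simp add: P_def)
qed

text \<open>Symmetry and positive semidefiniteness are read off the spectral form, whose
  coefficients \<open>lam i powr t\<close> are nonnegative; the threshold on \<open>t\<close> serves
  the entrywise nonnegativity.\<close>

lemma doubly_nonnegative_psd_power:
  assumes "n > 0" and A: "A \<in> carrier_mat n n" and dnn: "doubly_nonnegative A"
    and t: "t \<ge> real (n ^ 3 + 1)"
  shows "doubly_nonnegative (psd_power A t)"
proof -
  obtain lam x where dec: "spectral_decomp A lam x"
    using positive_semidefinite_imp_spectral_decomp[OF A] dnn by (auto simp: doubly_nonnegative_def)
  define y where "y i r = x i $ r" for i r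
  have y: "orthonormal_upto n n y" and lam: "\<And>i. i < n \<Longrightarrow> lam i \<ge> 0"
    and A_eq: "\<And>r s. r < n \<Longrightarrow> s < n \<Longrightarrow> A $$ (r, s) = spec_sum n lam y r s"
    using dec by (auto simp: spectral_decomp_iff[OF A] y_def[abs_def])
  define b where "b = spec_sum n (\<lambda>i. lam i powr t) y"
  define B where "B = psd_power A t"
  have B_eq: "B = mat n n (\<lambda>(r, s). b r s)"
    unfolding B_def b_def psd_power_eq[OF A dec] y_def ..
  then have B: "B \<in> carrier_mat n n" by simp
  have sym: "B\<^sup>T = B"
    unfolding B_eq b_def by (intro eq_matI) (auto simp: spec_sum_commute)
  have "scalar_prod v (B *\<^sub>v v) \<ge> 0" if "v \<in> carrier_vec n" for v
  proof -
    have "scalar_prod v (B *\<^sub>v v) = ip n (\<lambda>r. v $ r) (mulv n b (\<lambda>r. v $ r))"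
      using B that by (intro scalar_prod_mult_mat_vec_eq_ip) (auto simp: B_eq)
    also have "\<dots> \<ge> 0"
      unfolding b_def ip_mulv_spec_sum by (intro sum_nonneg) (simp add: mult.assoc)
    finally show ?thesis .
  qed
  moreover have "b r s \<ge> 0" if "r < n" "s < n" for r s
    unfolding b_def using dnn A A_eq
    by (intro spec_sum_powr_nonneg[OF \<open>n > 0\<close> y lam _ t that])
      (auto simp: doubly_nonnegative_def)
  ultimately show ?thesis
    using B sym unfolding doubly_nonnegative_def positive_semidefinite_def B_def[symmetric]
    by (auto simp: B_eq)
qed

theorem theorem2p2:
  shows "\<exists>m :: nat \<Rightarrow> real. \<forall>n > 0. \<forall>A \<in> carrier_mat n n.
           doubly_nonnegative A \<longrightarrow> (\<forall>t :: real. t \<ge> m n \<longrightarrow> t > 0 \<longrightarrow> doubly_nonnegative (psd_power A t))"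
  by (intro exI[of _ "\<lambda>n. real (n ^ 3 + 1)"] allI ballI impI doubly_nonnegative_psd_power)

end
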